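(* Let $G$ be an edge-maximal cograph on $n\ge 2$ vertices that does not contain $K_{3,3}$. Then $G$ is the product of a two-vertex cograph $G_1$ with another cograph $G_2$. Moreover, for every $n\ge 2$ there is such an edge-maximal cograph on $n$ vertices for which $G_1$ is an edge and $G_2$ is a sum of cliques.
   Context: Graphs are finite and simple. A cograph is a graph with no induced path $P_4$ on four vertices; the null graph (no vertices) is allowed as a cograph and is the identity for sum and product. The sum $G_1+G_2$ is the disjoint union; the product (join) $G_1\times G_2$ is the disjoint union together with all edges between $V(G_1)$ and $V(G_2)$. "Contains $K_{3,3}$" means contains it as a (not necessarily induced) subgraph. An edge-maximal cograph on $n$ vertices not containing $K_{3,3}$ is one with the maximum number of edges among all $n$-vertex cographs not containing $K_{3,3}$. A clique is a complete graph. *)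

theory Defs
  imports "Graph_Theory.Graph_Theory"
begin

text \<open>
  A finite simple graph is a \<open>pair_graph\<close>: a finite vertex set together with a finite,
  symmetric and irreflexive adjacency relation \<open>parcs\<close>.  Every edge thus
  occurs in \<open>parcs\<close> once in each direction.
\<close>

definition edges :: "'a pair_pre_digraph \<Rightarrow> 'a set set" where
  "edges G = (\<lambda>(u, v). {u, v}) ` parcs G"

definition is_P4 :: "'a pair_pre_digraph \<Rightarrow> bool" where
  "is_P4 P \<longleftrightarrow> (\<exists>a b c d. distinct [a, b, c, d] \<and> pverts P = {a, b, c, d} \<and>
     parcs P = {(a, b), (b, a), (b, c), (c, b), (c, d), (d, c)})"

definition cograph :: "'a pair_pre_digraph \<Rightarrow> bool" where
  "cograph G \<longleftrightarrow> pair_graph G \<and>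
     \<not> (\<exists>P. is_P4 P \<and> induced_subgraph (with_proj P) (with_proj G))"

definition contains_K33 :: "'a pair_pre_digraph \<Rightarrow> bool" where
  "contains_K33 G \<longleftrightarrow>
     (\<exists>H. subgraph (with_proj H) (with_proj G) \<and> complete_bipartite_digraph 3 3 (with_proj H))"

definition clique :: "'a pair_pre_digraph \<Rightarrow> bool" where
  "clique G \<longleftrightarrow> (\<exists>n. complete_digraph n (with_proj G))"

text \<open>
  Sum and product of graphs with disjoint vertex sets; disjointness has to be required
  wherever they are used.
\<close>

definition null_graph :: "'a pair_pre_digraph" where
  "null_graph = \<lparr>pverts = {}, parcs = {}\<rparr>"

definition gsum :: "'a pair_pre_digraph \<Rightarrow> 'a pair_pre_digraph \<Rightarrow> 'a pair_pre_digraph" where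
  "gsum G H = \<lparr>pverts = pverts G \<union> pverts H, parcs = parcs G \<union> parcs H\<rparr>"

definition gprod :: "'a pair_pre_digraph \<Rightarrow> 'a pair_pre_digraph \<Rightarrow> 'a pair_pre_digraph" where
  "gprod G H = \<lparr>pverts = pverts G \<union> pverts H,
     parcs = parcs G \<union> parcs H \<union> pverts G \<times> pverts H \<union> pverts H \<times> pverts G\<rparr>"

inductive sum_of_cliques :: "'a pair_pre_digraph \<Rightarrow> bool" where
  empty: "sum_of_cliques null_graph"
| add: "\<lbrakk>clique K; sum_of_cliques G; pverts K \<inter> pverts G = {}\<rbrakk> \<Longrightarrow> sum_of_cliques (gsum K G)"

text \<open>
  The competitors \<open>H\<close> live on the same vertex type as \<open>G\<close>.  This is no restriction:
  a graph with \<open>n\<close> vertices is isomorphic to one on the \<open>n\<close>-element vertex set of \<open>G\<close>.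
\<close>

definition edge_maximal_K33_free_cograph :: "nat \<Rightarrow> 'a pair_pre_digraph \<Rightarrow> bool" where
  "edge_maximal_K33_free_cograph n G \<longleftrightarrow>
     cograph G \<and> card (pverts G) = n \<and> \<not> contains_K33 G \<and>
     (\<forall>H :: 'a pair_pre_digraph. cograph H \<and> card (pverts H) = n \<and> \<not> contains_K33 H
        \<longrightarrow> card (edges H) \<le> card (edges G))"

end

theory Submission
  imports Defs
begin

text \<open>
  By complement symmetry, a cograph with at least two vertices is a sum or a product of two smaller
  ones, and in a \<open>K\<^sub>3\<^sub>,\<^sub>3\<close>-free product one factor has at most two vertices.  So unless some
  two-vertex set is joined to all other vertices, the graph is either disconnected or a single vertex
  joined to a disconnected graph; it is then glued from two smaller induced subgraphs sharing at most
  one vertex, and induction makes its number of edges strictly smaller than the extremal number.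

  If a set \<open>S\<close> of two vertices is joined to the \<open>m\<close> others, the latter induce a graph of maximum
  degree at most two, hence with at most \<open>m\<close> edges.  If \<open>S\<close> is an edge and there are \<open>m\<close> such edges,
  that graph is 2-regular; having neither an induced \<open>P\<^sub>4\<close> nor a 4-cycle, it is a sum of triangles,
  and \<open>m\<close> is divisible by 3.  The maximum is therefore \<open>3 m + 1\<close> if 3 divides \<open>m\<close> and \<open>3 m\<close>
  otherwise, and it is attained by the product of an edge with a sum of triangles and at most one
  smaller clique.
\<close>

section \<open>Graphs as sets of arcs\<close>

lemma pair_graph_iff:
  "pair_graph G \<longleftrightarrow> finite (pverts G) \<and> parcs G \<subseteq> pverts G \<times> pverts G \<and> sym (parcs G) \<and> irrefl (parcs G)"
  (is "_ \<longleftrightarrow> ?R")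
proof
  assume "pair_graph G"
  then interpret pair_graph G .
  have "(u, u) \<notin> parcs G" for u
    using no_loops'[of u u] by blast
  then show ?R
    using pair_finite_verts wellformed' arcs_symmetric
    by (auto simp: sym_def irrefl_def)
next
  assume R: ?R
  then have "finite (parcs G)"
    using finite_subset by blast
  with R show "pair_graph G"
    by unfold_locales (auto simp: symmetric_def irrefl_def)
qed

lemma pair_graphD:
  assumes "pair_graph G"
  shows "finite (pverts G)" "finite (parcs G)" "parcs G \<subseteq> pverts G \<times> pverts G"
    "(u, v) \<in> parcs G \<Longrightarrow> u \<in> pverts G" "(u, v) \<in> parcs G \<Longrightarrow> v \<in> pverts G"
    "(u, v) \<in> parcs G \<Longrightarrow> (v, u) \<in> parcs G" "(u, u) \<notin> parcs G"
  using assms by (auto simp: pair_graph_iff sym_def irrefl_def intro: finite_subset[of "parcs G"])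

text \<open>A walk \<open>a, b, c, d\<close> with a repeated vertex satisfies the disjunction by
  itself: \<open>a = c\<close> or \<open>b = d\<close> makes \<open>a\<close> adjacent to
  \<open>d\<close>, and \<open>a = d\<close> makes \<open>a\<close> adjacent to \<open>c\<close>.
  Failure of the disjunction therefore forces four distinct vertices, hence an induced path.\<close>

lemma cograph_iff:
  "cograph G \<longleftrightarrow> pair_graph G \<and>
     (\<forall>a b c d. (a, b) \<in> parcs G \<longrightarrow> (b, c) \<in> parcs G \<longrightarrow> (c, d) \<in> parcs G \<longrightarrow>
        (a, c) \<in> parcs G \<or> (a, d) \<in> parcs G \<or> (b, d) \<in> parcs G)"
proof (cases "pair_graph G")
  case True
  note G = pair_graphD[OF True]
  have wf: "wf_digraph (with_proj G)"
    using True by (simp add: wf_digraph_wp_iff pair_graph.axioms pair_digraph.pair_wf_digraph)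
  show ?thesis
  proof (intro iffI conjI True allI impI)
    fix a b c d
    assume co: "cograph G" and arcs: "(a, b) \<in> parcs G" "(b, c) \<in> parcs G" "(c, d) \<in> parcs G"
    show "(a, c) \<in> parcs G \<or> (a, d) \<in> parcs G \<or> (b, d) \<in> parcs G"
    proof (rule ccontr)
      assume N: "\<not> ?thesis"
      have dist: "distinct [a, b, c, d]"
        using arcs N G(6)[of a b] G(7) by auto
      define P where "P = \<lparr>pverts = {a, b, c, d},
        parcs = {(a, b), (b, a), (b, c), (c, b), (c, d), (d, c)}\<rparr>"
      have "is_P4 P"
        unfolding is_P4_def using dist by (intro exI[of _ a] exI[of _ b] exI[of _ c] exI[of _ d]) (simp add: P_def)
      moreover have "parcs P = {e \<in> parcs G. fst e \<in> pverts P \<and> snd e \<in> pverts P}"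
      proof -
        have "(b, a) \<in> parcs G" "(c, b) \<in> parcs G" "(d, c) \<in> parcs G"
          "(c, a) \<notin> parcs G" "(d, a) \<notin> parcs G" "(d, b) \<notin> parcs G"
          using arcs N G(6) by blast+
        with arcs N G(7)[of a] G(7)[of b] G(7)[of c] G(7)[of d] show ?thesis
          unfolding P_def by (intro set_eqI) (simp only: split_paired_all, simp, blast)
      qed
      moreover have "pverts P \<subseteq> pverts G"
        using arcs G(4,5) by (auto simp: P_def)
      moreover have "wf_digraph (with_proj P)"
        by (unfold_locales) (auto simp: P_def)
      ultimately have "induced_subgraph (with_proj P) (with_proj G)"
        unfolding induced_subgraph_def subgraph_def compatible_def using wf by auto
      with \<open>is_P4 P\<close> co show False
        unfolding cograph_def by blast
    qed
  next
    assume R: "pair_graph G \<and>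
     (\<forall>a b c d. (a, b) \<in> parcs G \<longrightarrow> (b, c) \<in> parcs G \<longrightarrow> (c, d) \<in> parcs G \<longrightarrow>
        (a, c) \<in> parcs G \<or> (a, d) \<in> parcs G \<or> (b, d) \<in> parcs G)"
    show "cograph G"
      unfolding cograph_def
    proof (intro conjI True notI)
      assume "\<exists>P. is_P4 P \<and> induced_subgraph (with_proj P) (with_proj G)"
      then obtain P where "is_P4 P" and ind: "induced_subgraph (with_proj P) (with_proj G)"
        by blast
      then obtain a b c d where P: "distinct [a, b, c, d]" "pverts P = {a, b, c, d}"
        "parcs P = {(a, b), (b, a), (b, c), (c, b), (c, d), (d, c)}"
        unfolding is_P4_def by blast
      have eq: "(u, v) \<in> parcs P \<longleftrightarrow> (u, v) \<in> parcs G" if "u \<in> pverts P" "v \<in> pverts P" for u v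
        using ind that unfolding induced_subgraph_def by auto
      have "(a, b) \<in> parcs G" "(b, c) \<in> parcs G" "(c, d) \<in> parcs G"
        "(a, c) \<notin> parcs G" "(a, d) \<notin> parcs G" "(b, d) \<notin> parcs G"
        using eq[of a b] eq[of b c] eq[of c d] eq[of a c] eq[of a d] eq[of b d] P by auto
      with R show False
        by blast
    qed
  qed
qed (simp add: cograph_def)

text \<open>A copy that need not be induced is determined by its two sides. Symmetry of
  \<open>G\<close> supplies the arcs from \<open>W\<close> back to \<open>U\<close>, so one
  direction describes the whole copy.\<close>

lemma contains_K33_iff:
  assumes "pair_graph G"
  shows "contains_K33 G \<longleftrightarrow> (\<exists>U W. U \<inter> W = {} \<and> card U = 3 \<and> card W = 3 \<and> U \<times> W \<subseteq> parcs G)"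
    (is "_ \<longleftrightarrow> ?R")
proof
  assume "contains_K33 G"
  then show ?R
    unfolding contains_K33_def complete_bipartite_digraph_pair_def subgraph_def
    by (elim exE conjE) (intro exI conjI, assumption+, auto)
next
  note G = pair_graphD[OF assms]
  assume ?R
  then obtain U W where UW: "U \<inter> W = {}" "card U = 3" "card W = 3" "U \<times> W \<subseteq> parcs G"
    by blast
  define H where "H = \<lparr>pverts = U \<union> W, parcs = U \<times> W \<union> W \<times> U\<rparr>"
  \<comment> \<open>An infinite set has \<open>card\<close> 0, so cardinality 3 yields finiteness.
    Nonemptiness gives each vertex of one side an arc to the other side, which places it in
    \<open>pverts G\<close>.\<close>
  have "finite U" "finite W" "U \<noteq> {}" "W \<noteq> {}"
    using UW(2,3) by (auto intro: card_ge_0_finite)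
  then have "complete_bipartite_digraph 3 3 (with_proj H)" "pverts H \<subseteq> pverts G"
    unfolding complete_bipartite_digraph_pair_def using UW G(4,5) by (auto simp: H_def)
  moreover have "parcs H \<subseteq> parcs G"
    using UW(4) G(6) unfolding H_def by auto
  moreover have "wf_digraph (with_proj H)"
    by unfold_locales (auto simp: H_def)
  moreover have "wf_digraph (with_proj G)"
    using assms by (simp add: wf_digraph_wp_iff pair_graph.axioms pair_digraph.pair_wf_digraph)
  ultimately show "contains_K33 G"
    unfolding contains_K33_def subgraph_def compatible_def by auto
qed

section \<open>Induced subgraphs\<close>

definition induce :: "'a pair_pre_digraph \<Rightarrow> 'a set \<Rightarrow> 'a pair_pre_digraph" where
  "induce G A = \<lparr>pverts = A, parcs = parcs G \<inter> A \<times> A\<rparr>"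

lemma induce_simps [simp]:
  "pverts (induce G A) = A" "parcs (induce G A) = parcs G \<inter> A \<times> A"
  by (simp_all add: induce_def)

lemma pair_graph_induce:
  "pair_graph G \<Longrightarrow> A \<subseteq> pverts G \<Longrightarrow> pair_graph (induce G A)"
  unfolding pair_graph_iff sym_def irrefl_def by (auto intro: finite_subset)

lemma cograph_induce:
  "cograph G \<Longrightarrow> A \<subseteq> pverts G \<Longrightarrow> cograph (induce G A)"
  unfolding cograph_iff by (simp add: pair_graph_induce)

lemma K33_free_induce:
  assumes "pair_graph G" "A \<subseteq> pverts G" "\<not> contains_K33 G"
  shows "\<not> contains_K33 (induce G A)"
  using assms contains_K33_iff[OF assms(1)] contains_K33_iff[OF pair_graph_induce[OF assms(1,2)]]
  by simp blast

section \<open>Counting edges through arcs\<close>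

lemma finite_edges: "pair_graph G \<Longrightarrow> finite (edges G)"
  unfolding edges_def using pair_graphD(2) by blast

text \<open>The fibre of \<open>(u, v) \<mapsto> {u, v}\<close> over an edge consists of its two
  orientations, which differ because there are no loops.\<close>

lemma card_parcs_eq:
  assumes "pair_graph G"
  shows "card (parcs G) = 2 * card (edges G)"
proof -
  note G = pair_graphD[OF assms]
  let ?f = "\<lambda>(u, v). {u, v}"
  have "card {p \<in> parcs G. ?f p = e} = 2" if e: "e \<in> edges G" for e
  proof -
    obtain u v where uv: "e = {u, v}" "(u, v) \<in> parcs G"
      using e unfolding edges_def by auto
    have "{p \<in> parcs G. ?f p = e} = {(u, v), (v, u)}"
      using uv G(6) by (auto simp: doubleton_eq_iff)
    moreover have "u \<noteq> v"
      using uv G(7) by blast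
    ultimately show ?thesis
      by simp
  qed
  then have "(\<Sum>e\<in>edges G. card {p \<in> parcs G. ?f p = e}) = 2 * card (edges G)"
    by simp
  moreover have "(\<Sum>e\<in>edges G. card {p \<in> parcs G. ?f p = e}) = card (parcs G)"
    using sum.group[of "parcs G" "edges G" ?f "\<lambda>_. 1 :: nat"] G(2) finite_edges[OF assms]
    by (simp add: edges_def)
  ultimately show ?thesis
    by simp
qed

lemma card_parcs_sum_degrees:
  assumes "pair_graph G"
  shows "card (parcs G) = (\<Sum>x\<in>pverts G. card {y. (x, y) \<in> parcs G})"
proof -
  note G = pair_graphD[OF assms]
  have "parcs G = (SIGMA x : pverts G. {y. (x, y) \<in> parcs G})"
    using G(4) by auto
  moreover have "finite {y. (x, y) \<in> parcs G}" for x
    by (rule finite_subset[OF _ G(1)]) (use G(5) in auto)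
  ultimately show ?thesis
    using card_SigmaI[OF G(1), of "\<lambda>x. {y. (x, y) \<in> parcs G}"] by simp
qed

section \<open>Decomposition of cographs\<close>

text \<open>Phrased for a relation on a set rather than for a graph, so that it also applies to the
  complement, which is reflexive when the relation is irreflexive.\<close>

definition P4_free_on :: "'a set \<Rightarrow> ('a \<Rightarrow> 'a \<Rightarrow> bool) \<Rightarrow> bool" where
  "P4_free_on V R \<longleftrightarrow> (\<forall>a\<in>V. \<forall>b\<in>V. \<forall>c\<in>V. \<forall>d\<in>V. distinct [a, b, c, d] \<longrightarrow>
     R a b \<longrightarrow> R b c \<longrightarrow> R c d \<longrightarrow> R a c \<or> R a d \<or> R b d)"

text \<open>For adjacency this expresses disconnectedness; for its negation it says that the vertex
  set is a join of \<open>A\<close> and \<open>B\<close>.\<close>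

definition separation :: "'a set \<Rightarrow> ('a \<Rightarrow> 'a \<Rightarrow> bool) \<Rightarrow> 'a set \<Rightarrow> 'a set \<Rightarrow> bool" where
  "separation V R A B \<longleftrightarrow> A \<noteq> {} \<and> B \<noteq> {} \<and> A \<inter> B = {} \<and> A \<union> B = V \<and> (\<forall>a\<in>A. \<forall>b\<in>B. \<not> R a b)"

lemma separation_commute:
  "symp R \<Longrightarrow> separation V R A B \<Longrightarrow> separation V R B A"
  unfolding separation_def symp_def by blast

text \<open>The path on four vertices is self-complementary: the complement of the path
  \<open>a, b, c, d\<close> is the path \<open>c, a, d, b\<close>.\<close>

lemma P4_free_on_complement:
  assumes "symp R" "P4_free_on V R"
  shows "P4_free_on V (\<lambda>x y. \<not> R x y)"
  unfolding P4_free_on_def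
proof (intro ballI impI)
  fix a b c d
  assume "a \<in> V" "b \<in> V" "c \<in> V" "d \<in> V" "distinct [a, b, c, d]"
  moreover have "R x y \<longleftrightarrow> R y x" for x y
    using assms(1) by (auto simp: symp_def)
  ultimately show "\<not> R a b \<Longrightarrow> \<not> R b c \<Longrightarrow> \<not> R c d \<Longrightarrow> \<not> R a c \<or> \<not> R a d \<or> \<not> R b d"
    using assms(2)[unfolded P4_free_on_def, rule_format, of c a d b] by auto
qed

text \<open>A new vertex \<open>v\<close> adjacent to all of \<open>U\<close> splits off in the
  complement. Otherwise some side contains a non-neighbour of \<open>v\<close>, and either
  \<open>v\<close> can be added to that side or the non-neighbours in it can be cut off.\<close>

lemma separation_insert:
  assumes R: "symp R" and P4: "P4_free_on (insert v U) R" and v: "v \<notin> U"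
    and sep: "separation U R A B"
  shows "\<exists>A' B'. separation (insert v U) R A' B' \<or> separation (insert v U) (\<lambda>x y. \<not> R x y) A' B'"
proof (cases "\<forall>x\<in>U. R v x")
  case True
  then have "separation (insert v U) (\<lambda>x y. \<not> R x y) {v} U"
    using sep v unfolding separation_def by auto
  then show ?thesis
    by blast
next
  case False
  \<comment> \<open>By symmetry of the separation, \<open>A\<close> may be taken as the side
    containing a non-neighbour of \<open>v\<close>.\<close>
  then obtain x A B where sep: "separation U R A B" and x: "x \<in> A" "\<not> R v x"
    using sep separation_commute[OF R sep] unfolding separation_def by blast
  have sym: "R a b \<longleftrightarrow> R b a" for a b
    using R by (auto simp: symp_def)
  define A1 where "A1 = {a \<in> A. \<not> R v a}"
  show ?thesis
  proof (cases "\<exists>a0\<in>A - A1. \<exists>a1\<in>A1. R a0 a1")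
    case True
    then obtain a0 a1 where a: "a0 \<in> A" "R v a0" "a1 \<in> A" "\<not> R v a1" "R a0 a1"
      unfolding A1_def by blast
    \<comment> \<open>A neighbour \<open>b\<close> of \<open>v\<close> in \<open>B\<close> would
      make \<open>b, v, a0, a1\<close> an induced path, so \<open>v\<close> has all its neighbours
      in \<open>A\<close>.\<close>
    have "\<not> R b v" if "b \<in> B" for b
    proof
      assume "R b v"
      have "b \<in> U" "a0 \<in> U" "a1 \<in> U" "\<not> R b a0" "\<not> R b a1"
        using that a sep sym unfolding separation_def by blast+
      moreover have "distinct [b, v, a0, a1]"
        using a v calculation that sep \<open>R b v\<close> unfolding separation_def by auto
      ultimately show False
        using P4[unfolded P4_free_on_def, rule_format, of b v a0 a1] a \<open>R b v\<close> by blast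
    qed
    then have "separation (insert v U) R (insert v A) B"
      using sep v sym unfolding separation_def by blast
    then show ?thesis
      by blast
  next
    case False
    \<comment> \<open>\<open>A1\<close> contains \<open>x\<close> and has no neighbour in the rest
      of \<open>A\<close>, in \<open>B\<close>, or at \<open>v\<close>.\<close>
    then have "separation (insert v U) R A1 (insert v (U - A1))"
      using sep v sym x unfolding separation_def A1_def by blast
    then show ?thesis
      by blast
  qed
qed

text \<open>Vertices are added one at a time. If the smaller set is separated in the complement, the
  insertion lemma is applied to the negated relation, whose conclusion is the same up to
  order.\<close>

lemma P4_free_on_separation:
  assumes "finite V" "2 \<le> card V" "symp R" "P4_free_on V R"
  shows "\<exists>A B. separation V R A B \<or> separation V (\<lambda>x y. \<not> R x y) A B"
  using assms
proof (induction V rule: finite_induct)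
  case (insert v U)
  have symc: "symp (\<lambda>x y. \<not> R x y)"
    using insert.prems by (auto simp: symp_def)
  show ?case
  proof (cases "2 \<le> card U")
    case True
    have "P4_free_on U R"
      using insert.prems unfolding P4_free_on_def by blast
    with insert True obtain A B
      where "separation U R A B \<or> separation U (\<lambda>x y. \<not> R x y) A B"
      by blast
    then show ?thesis
    proof
      assume "separation U R A B"
      then show ?thesis
        using separation_insert[OF insert.prems(2,3) insert.hyps(2)] by simp
    next
      assume "separation U (\<lambda>x y. \<not> R x y) A B"
      then show ?thesis
        using separation_insert[OF symc P4_free_on_complement[OF insert.prems(2,3)] insert.hyps(2)]
        by (simp add: disj_commute)
    qed
  next
    case False
    then have "card U = 1"
      using insert by simp
    then obtain u where "U = {u}"
      by (auto simp: card_1_singleton_iff)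
    then show ?thesis
      using insert.hyps unfolding separation_def by (intro exI[of _ "{v}"] exI[of _ "{u}"]) auto
  qed
qed simp

lemma cograph_disconnected_or_join:
  assumes co: "cograph G" and "2 \<le> card (pverts G)"
  obtains A B where "A \<noteq> {}" "B \<noteq> {}" "A \<inter> B = {}" "A \<union> B = pverts G"
      "parcs G \<subseteq> A \<times> A \<union> B \<times> B"
    | A B where "A \<noteq> {}" "B \<noteq> {}" "A \<inter> B = {}" "A \<union> B = pverts G" "A \<times> B \<subseteq> parcs G"
proof -
  have pg: "pair_graph G"
    using co by (simp add: cograph_iff)
  note G = pair_graphD[OF pg]
  define R where "R = (\<lambda>x y. (x, y) \<in> parcs G)"
  have "symp R"
    using G(6) by (auto simp: R_def symp_def)
  moreover have "P4_free_on (pverts G) R"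
    using co unfolding cograph_iff P4_free_on_def R_def by blast
  ultimately obtain A B
    where "separation (pverts G) R A B \<or> separation (pverts G) (\<lambda>x y. \<not> R x y) A B"
    using P4_free_on_separation[OF G(1) assms(2)] by blast
  then show thesis
  proof
    assume sep: "separation (pverts G) R A B"
    then have "parcs G \<subseteq> A \<times> A \<union> B \<times> B"
      using G(3,6) unfolding separation_def R_def by (intro subrelI) blast
    with sep show thesis
      by (intro that(1)[of A B]) (auto simp: separation_def)
  next
    assume "separation (pverts G) (\<lambda>x y. \<not> R x y) A B"
    then show thesis
      by (intro that(2)[of A B]) (auto simp: separation_def R_def)
  qed
qed

section \<open>Splitting a \<open>K33\<close>-free cograph into pieces\<close>

lemma edges_cover:
  assumes "pair_graph G" "A \<subseteq> pverts G" "B \<subseteq> pverts G" "parcs G \<subseteq> A \<times> A \<union> B \<times> B"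
  shows "card (edges G) \<le> card (edges (induce G A)) + card (edges (induce G B))"
proof -
  have "edges G \<subseteq> edges (induce G A) \<union> edges (induce G B)"
    using assms(4) by (fastforce simp: edges_def)
  then have "card (edges G) \<le> card (edges (induce G A) \<union> edges (induce G B))"
    using assms by (intro card_mono finite_UnI finite_edges pair_graph_induce)
  then show ?thesis
    using card_Un_le le_trans by blast
qed

text \<open>
  The second case covers two situations: \<open>G\<close> is disconnected (\<open>A \<inter> B = {}\<close>), or \<open>G\<close> is the join of a
  vertex \<open>v\<close> with a disconnected graph (\<open>A \<inter> B = {v}\<close>).
\<close>
lemma K33_free_cograph_cases:
  assumes co: "cograph G" and K33: "\<not> contains_K33 G" and card: "2 \<le> card (pverts G)"
  obtains S where "S \<subseteq> pverts G" "card S = 2" "S \<times> (pverts G - S) \<subseteq> parcs G"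
    | A B where "A \<subset> pverts G" "B \<subset> pverts G" "A \<union> B = pverts G" "card (A \<inter> B) \<le> 1"
        "parcs G \<subseteq> A \<times> A \<union> B \<times> B"
proof -
  have pg: "pair_graph G"
    using co by (simp add: cograph_iff)
  note G = pair_graphD[OF pg]
  have small: "card X \<le> 2 \<or> card Y \<le> 2" if XY: "X \<times> Y \<subseteq> parcs G" "X \<inter> Y = {}" for X Y
  proof (rule ccontr)
    assume "\<not> ?thesis"
    then have "3 \<le> card X" "3 \<le> card Y"
      by auto
    then obtain U W where "U \<subseteq> X" "card U = 3" "W \<subseteq> Y" "card W = 3"
      by (meson obtain_subset_with_card_n)
    moreover from this have "U \<times> W \<subseteq> parcs G" "U \<inter> W = {}"
      using XY by blast+
    ultimately show False
      using K33 contains_K33_iff[OF pg] by blast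
  qed
  from co card show thesis
  proof (cases rule: cograph_disconnected_or_join)
    case (1 A B)
    then show thesis
      by (intro that(2)[of A B]) auto
  next
    case (2 A B)
    obtain X Y where XY: "X \<noteq> {}" "Y \<noteq> {}" "X \<inter> Y = {}" "X \<union> Y = pverts G"
      "X \<times> Y \<subseteq> parcs G" "card X \<le> 2"
    proof (cases "card A \<le> 2")
      case True
      then show thesis
        using 2 that[of A B] by blast
    next
      case False
      then have "card B \<le> 2"
        using small[of A B] 2 by blast
      moreover have "B \<times> A \<subseteq> parcs G"
        using 2 G(6) by auto
      ultimately show thesis
        using 2 that[of B A] by blast
    qed
    have fin: "finite X" "finite Y"
      using XY(4) G(1) by (metis finite_Un)+
    show thesis
    proof (cases "card X = 2")
      case True
      have "pverts G - X = Y"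
        using XY by blast
      with True XY show thesis
        by (intro that(1)[of X]) auto
    next
      case False
      then have "card X = 1"
        using False XY(1,6) fin(1) card_gt_0_iff[of X] by auto
      then obtain v where v: "X = {v}"
        by (auto simp: card_1_singleton_iff)
      have Y: "Y = pverts G - {v}" "v \<in> pverts G"
        using XY v by blast+
      show thesis
      proof (cases "card Y \<ge> 2")
        case False
        then have "card (pverts G) = 2"
          using card Y G(1) by (simp add: card_Diff_singleton)
        \<comment> \<open>With only two vertices, \<open>S\<close> is the whole vertex set and the
          joining condition is vacuous.\<close>
        then show thesis
          by (intro that(1)[of "pverts G"]) auto
      next
        case True
        have "cograph (induce G Y)"
          using cograph_induce[OF co] Y by blast
        moreover have "2 \<le> card (pverts (induce G Y))"
          using True by simp
        ultimately show thesis
        proof (cases rule: cograph_disconnected_or_join)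
          case (1 C D)
          \<comment> \<open>The rest \<open>Y\<close> is disconnected, so \<open>v\<close> is put
            back into both parts; it is their only common vertex.\<close>
          have C: "insert v C \<subset> pverts G" "insert v D \<subset> pverts G" "insert v C \<union> insert v D = pverts G"
            and CD: "insert v C \<inter> insert v D = {v}"
            using 1(1-4) Y by auto
          have "parcs G \<subseteq> insert v C \<times> insert v C \<union> insert v D \<times> insert v D"
          proof (rule subrelI)
            fix x y
            assume xy: "(x, y) \<in> parcs G"
            show "(x, y) \<in> insert v C \<times> insert v C \<union> insert v D \<times> insert v D"
            proof (cases "x = v \<or> y = v")
              case True
              then show ?thesis
                using G(4,5)[OF xy] C(3) by auto
            next
              case False
              then have "(x, y) \<in> parcs (induce G Y)"
                using xy G(4,5)[OF xy] Y by auto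
              then show ?thesis
                using 1(5) by auto
            qed
          qed
          then show thesis
            by (intro that(2)[OF C]) (simp_all only: CD, simp)
        next
          case (2 C D)
          have CD: "C \<times> D \<subseteq> parcs G" "D \<times> C \<subseteq> parcs G"
            using 2(5) G(6) by auto
          \<comment> \<open>\<open>Y\<close> is itself a join, named so that \<open>C\<close> is a
            side with at most two vertices. If \<open>C\<close> has two, it serves as
            \<open>S\<close>, being joined to \<open>v\<close> as well; if it has one,
            \<open>insert v C\<close> does.\<close>
          obtain C D where CD: "C \<noteq> {}" "D \<noteq> {}" "C \<inter> D = {}" "C \<union> D = Y" "C \<times> D \<subseteq> parcs G" "card C \<le> 2"
            using small[of C D] 2(1-4) CD that[of C D] that[of D C] by auto
          have finC: "finite C"
            using CD(4) fin(2) by (metis finite_Un)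
          have vC: "(c, v) \<in> parcs G" "(v, c) \<in> parcs G" if "c \<in> Y" for c
            using XY(5) v that G(6) by auto
          show thesis
          proof (cases "card C = 2")
            case True
            have "pverts G - C = insert v D"
              using CD Y by auto
            moreover have "C \<times> insert v D \<subseteq> parcs G"
              using CD vC by auto
            ultimately show thesis
              using True CD Y by (intro that(1)[of C]) auto
          next
            case False
            then have "card C = 1"
              using False CD(1,6) finC card_gt_0_iff[of C] by auto
            then have "card (insert v C) = 2"
              using finC CD Y by (auto simp: card_insert_if)
            moreover have "pverts G - insert v C = D"
              using CD Y by auto
            moreover have "insert v C \<times> D \<subseteq> parcs G"
              using CD vC by auto
            ultimately show thesis
              using CD Y by (intro that(1)[of "insert v C"]) auto
          qed
        qed
      qed
    qed
  qed
qed

section \<open>The extremal number\<close>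

text \<open>The maximal number of edges. The value 0 below 2 covers the pieces with at most one
  vertex that arise in the induction; at 2 the divisibility term counts the single edge.\<close>

definition ex_K33 :: "nat \<Rightarrow> nat" where
  "ex_K33 n = (if n < 2 then 0 else 3 * (n - 2) + (if 3 dvd n - 2 then 1 else 0))"

text \<open>Adjacency together with equality is an equivalence relation, and each class consists of
  a vertex and its two neighbours.\<close>

lemma dvd_card_vertices_of_triangles:
  assumes "pair_graph G"
    and deg: "\<And>x. x \<in> pverts G \<Longrightarrow> card {y. (x, y) \<in> parcs G} = 2"
    and trans: "\<And>x y z. (x, y) \<in> parcs G \<Longrightarrow> (y, z) \<in> parcs G \<Longrightarrow> x \<noteq> z \<Longrightarrow> (x, z) \<in> parcs G"
  shows "3 dvd card (pverts G)"
proof -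
  note G = pair_graphD[OF assms(1)]
  let ?r = "Id_on (pverts G) \<union> parcs G"
  have "equiv (pverts G) ?r"
  proof (rule equivI)
    show "trans ?r"
      unfolding trans_def using trans G(4) by (auto simp: Id_on_def)
  qed (use G(3,6) in \<open>auto simp: refl_on_def sym_def\<close>)
  moreover have "card X = 3" if X: "X \<in> pverts G // ?r" for X
  proof -
    obtain x where x: "x \<in> pverts G" "X = ?r `` {x}"
      using X by (elim quotientE)
    then have "X = insert x {y. (x, y) \<in> parcs G}"
      by auto
    moreover have "finite {y. (x, y) \<in> parcs G}"
      using deg[OF x(1)] by (intro card_ge_0_finite) simp
    ultimately show ?thesis
      using deg[OF x(1)] G(7) by simp
  qed
  ultimately show ?thesis
    using equiv_imp_dvd_card[OF G(1)] G(3) by (metis dvd_refl)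
qed

text \<open>Edges lie inside \<open>S\<close>, across, or inside the rest \<open>W\<close>. There
  are at most \<open>2 * card W\<close> across; the other two kinds together exceed
  \<open>card W\<close> only if \<open>S\<close> is an edge and \<open>W\<close> carries exactly
  \<open>card W\<close> edges.\<close>

lemma card_edges_two_vertex_join:
  assumes co: "cograph G" and K33: "\<not> contains_K33 G"
    and S: "S \<subseteq> pverts G" "card S = 2" "S \<times> (pverts G - S) \<subseteq> parcs G"
  shows "card (edges G) \<le> ex_K33 (card (pverts G))"
proof -
  have pg: "pair_graph G"
    using co by (simp add: cograph_iff)
  note G = pair_graphD[OF pg]
  obtain s t where st: "S = {s, t}" "s \<noteq> t"
    using S(2) by (meson card_2_iff)
  define W where "W = pverts G - S"
  define H where "H = induce G W"
  have W: "W \<subseteq> pverts G" "finite W"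
    using G(1) by (auto simp: W_def)
  have pH: "pair_graph H"
    using pair_graph_induce[OF pg W(1)] by (simp add: H_def)
  have m: "card W = card (pverts G) - 2" "2 \<le> card (pverts G)"
    using S G(1) card_mono[OF G(1) S(1)] by (auto simp: W_def card_Diff_subset finite_subset)
  have sW: "(s, x) \<in> parcs G" "(t, x) \<in> parcs G" "(x, s) \<in> parcs G" "(x, t) \<in> parcs G" if "x \<in> W" for x
    using S(3) that G(6) unfolding W_def st(1) by auto
  \<comment> \<open>Three neighbours of \<open>x\<close> inside \<open>W\<close> would form a
    \<open>K33\<close> with \<open>{s, t, x}\<close>.\<close>
  have deg: "card {y. (x, y) \<in> parcs H} \<le> 2" if x: "x \<in> W" for x
  proof (rule ccontr)
    assume "\<not> ?thesis"
    then obtain T where T: "T \<subseteq> {y. (x, y) \<in> parcs H}" "card T = 3"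
      using obtain_subset_with_card_n[of 3 "{y. (x, y) \<in> parcs H}"] by auto
    have "T \<subseteq> W"
      using T by (auto simp: H_def)
    have "{s, t, x} \<inter> T = {}"
      using T G(7) st by (auto simp: H_def W_def)
    moreover have "card {s, t, x} = 3"
      using x st by (auto simp: W_def)
    moreover have "{s, t, x} \<times> T \<subseteq> parcs G"
      using T sW \<open>T \<subseteq> W\<close> by (auto simp: H_def)
    ultimately show False
      using K33 T(2) contains_K33_iff[OF pg] by blast
  qed
  have sum_deg: "2 * card (edges H) = (\<Sum>x\<in>W. card {y. (x, y) \<in> parcs H})"
    using card_parcs_eq[OF pH] card_parcs_sum_degrees[OF pH] by (simp add: H_def)
  then have eH: "card (edges H) \<le> card W"
    using sum_bounded_above[of W "\<lambda>x. card {y. (x, y) \<in> parcs H}" 2] deg by simp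
  define E0 where "E0 = (if (s, t) \<in> parcs G then {{s, t}} else {})"
  have "edges G \<subseteq> E0 \<union> (\<lambda>(u, x). {u, x}) ` (S \<times> W) \<union> edges H"
  proof
    fix e
    assume "e \<in> edges G"
    then obtain u v where uv: "e = {u, v}" "(u, v) \<in> parcs G"
      by (auto simp: edges_def)
    have uvV: "u \<in> S \<or> u \<in> W" "v \<in> S \<or> v \<in> W"
      using G(4,5)[OF uv(2)] by (auto simp: W_def)
    consider "u \<in> S" "v \<in> S" | "u \<in> S" "v \<in> W" | "u \<in> W" "v \<in> S" | "u \<in> W" "v \<in> W"
      using uvV by blast
    then show "e \<in> E0 \<union> (\<lambda>(u, x). {u, x}) ` (S \<times> W) \<union> edges H"
    proof cases
      case 1
      then have "(s, t) \<in> parcs G" "e = {s, t}"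
        using uv G(6)[OF uv(2)] G(7) st by auto
      then show ?thesis
        by (simp add: E0_def)
    next
      case 2
      then show ?thesis
        using uv by force
    next
      case 3
      then have "e = (\<lambda>(u, x). {u, x}) (v, u)" "(v, u) \<in> S \<times> W"
        using uv by auto
      then show ?thesis
        by blast
    next
      case 4
      then show ?thesis
        using uv by (auto simp: edges_def H_def)
    qed
  qed
  then have "card (edges G) \<le> card (E0 \<union> (\<lambda>(u, x). {u, x}) ` (S \<times> W) \<union> edges H)"
    using W st finite_edges[OF pH] by (intro card_mono) (auto simp: E0_def)
  also have "\<dots> \<le> card E0 + card ((\<lambda>(u, x). {u, x}) ` (S \<times> W)) + card (edges H)"
    by (meson add_le_mono1 card_Un_le le_trans)
  also have "card ((\<lambda>(u, x). {u, x}) ` (S \<times> W)) \<le> 2 * card W"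
    using card_image_le[of "S \<times> W" "\<lambda>(u, x). {u, x}"] W st by (simp add: card_cartesian_product)
  finally have le: "card (edges G) \<le> card E0 + 2 * card W + card (edges H)"
    by simp
  have "3 dvd card W" if edge: "(s, t) \<in> parcs G" and eq: "card (edges H) = card W"
  proof -
    \<comment> \<open>The degrees are at most 2 and sum to \<open>2 * card W\<close>, so none can be
      smaller.\<close>
    have deg2: "card {y. (x, y) \<in> parcs H} = 2" if "x \<in> W" for x
    proof (rule ccontr)
      assume "card {y. (x, y) \<in> parcs H} \<noteq> 2"
      then have "(\<Sum>x\<in>W. card {y. (x, y) \<in> parcs H}) < (\<Sum>x\<in>W. 2)"
        using deg that W(2) by (intro sum_strict_mono_ex1) (auto simp: le_less)
      then show False
        using sum_deg eq by simp
    qed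
    \<comment> \<open>If \<open>x\<close> and \<open>z\<close> were not adjacent, \<open>x\<close>
      would have a second neighbour \<open>w\<close>, which is not adjacent to \<open>y\<close>
      because \<open>y\<close> already has its two neighbours. The path \<open>w, x, y, z\<close> is
      not induced, so \<open>w\<close> is adjacent to \<open>z\<close>, closing a 4-cycle.\<close>
    have "(x, z) \<in> parcs H" if xyz: "(x, y) \<in> parcs H" "(y, z) \<in> parcs H" "x \<noteq> z" for x y z
    proof (rule ccontr)
      assume nxz: "(x, z) \<notin> parcs H"
      note H = pair_graphD[OF pH]
      have V: "x \<in> W" "y \<in> W" "z \<in> W"
        using H(4,5) xyz by (auto simp: H_def)
      have Ny: "{u. (y, u) \<in> parcs H} = {x, z}"
      proof (rule card_seteq[symmetric])
        show "finite {u. (y, u) \<in> parcs H}"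
          using deg2[OF V(2)] by (intro card_ge_0_finite) simp
      qed (use xyz H(6) deg2[OF V(2)] in auto)
      obtain w where w: "(x, w) \<in> parcs H" "w \<noteq> y"
      proof -
        have "\<not> {u. (x, u) \<in> parcs H} \<subseteq> {y}"
        proof
          assume "{u. (x, u) \<in> parcs H} \<subseteq> {y}"
          then have "card {u. (x, u) \<in> parcs H} \<le> card {y}"
            by (intro card_mono) auto
          then show False
            using deg2[OF V(1)] by simp
        qed
        then show thesis
          using that by blast
      qed
      have "w \<in> W"
        using H(5)[OF w(1)] by (simp add: H_def)
      have "w \<noteq> x" "w \<noteq> z"
        using w H(7) nxz by auto
      then have "(w, y) \<notin> parcs H"
        using Ny H(6)[of w y] by blast
      moreover have "cograph H"
        using cograph_induce[OF co W(1)] by (simp add: H_def)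
      ultimately have "(w, z) \<in> parcs H"
        using nxz w(1) xyz H(6) unfolding cograph_iff by blast
      then have "(z, w) \<in> parcs G" "(x, w) \<in> parcs G" "(x, y) \<in> parcs G" "(z, y) \<in> parcs G"
        using w xyz H(6) by (auto simp: H_def)
      \<comment> \<open>Opposite pairs of the 4-cycle, each extended by one end of the edge
        \<open>s\<close>, \<open>t\<close>, are the sides of a \<open>K33\<close>.\<close>
      then have "{s, x, z} \<times> {t, y, w} \<subseteq> parcs G"
        using V \<open>w \<in> W\<close> sW edge by auto
      moreover have "x \<noteq> y" "y \<noteq> z"
        using xyz H(7) by auto
      then have "{s, x, z} \<inter> {t, y, w} = {}" "card {s, x, z} = 3" "card {t, y, w} = 3"
        using V \<open>w \<in> W\<close> w \<open>w \<noteq> x\<close> \<open>w \<noteq> z\<close> xyz(3) st by (auto simp: W_def)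
      ultimately show False
        using K33 contains_K33_iff[OF pg] by blast
    qed
    then have "3 dvd card (pverts H)"
      using deg2 by (intro dvd_card_vertices_of_triangles[OF pH]) (simp_all add: H_def)
    then show ?thesis
      by (simp add: H_def)
  qed
  then have "card E0 + card (edges H) \<le> card W + (if 3 dvd card W then 1 else 0)"
    using eH by (cases "card (edges H) = card W") (auto simp: E0_def)
  then show ?thesis
    using le m by (simp add: ex_K33_def)
qed

text \<open>The strictness alternative is what later yields the structure: a graph that attains the
  bound must have a pair joined to everything else.\<close>

lemma card_edges_K33_free_cograph:
  assumes "cograph G" "\<not> contains_K33 G" "card (pverts G) = n"
  shows "card (edges G) \<le> ex_K33 n \<and>
    (2 \<le> n \<longrightarrow> card (edges G) < ex_K33 n \<or>
      (\<exists>S \<subseteq> pverts G. card S = 2 \<and> S \<times> (pverts G - S) \<subseteq> parcs G))"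
  using assms
proof (induction n arbitrary: G rule: less_induct)
  case (less n)
  have pg: "pair_graph G"
    using less.prems by (simp add: cograph_iff)
  note G = pair_graphD[OF pg]
  show ?case
  proof (cases "2 \<le> n")
    case False
    then have "is_singleton (pverts G) \<or> pverts G = {}"
      using less.prems(3) G(1) by (cases n) (auto simp: is_singleton_altdef)
    then have "parcs G = {}"
      using G(3,7) by (auto simp: is_singleton_def)
    then show ?thesis
      using False by (simp add: edges_def)
  next
    case True
    then have "2 \<le> card (pverts G)"
      using less.prems(3) by simp
    with less.prems(1,2) show ?thesis
    proof (cases rule: K33_free_cograph_cases)
      case (1 S)
      then show ?thesis
        using card_edges_two_vertex_join[OF less.prems(1,2) 1] 1 less.prems(3) by auto
    next
      case (2 A B)
      have lt: "card A < n" "card B < n"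
        using 2 psubset_card_mono[OF G(1)] less.prems(3) by auto
      have fin: "finite A" "finite B"
        using 2 G(1) finite_subset by auto
      have sub: "A \<subseteq> pverts G" "B \<subseteq> pverts G"
        using 2 by auto
      have "card (edges (induce G X)) \<le> ex_K33 (card X)" if "X \<subseteq> pverts G" "card X < n" for X
        using less.IH[OF that(2) cograph_induce[OF less.prems(1) that(1)] K33_free_induce[OF pg that(1) less.prems(2)]]
        by simp
      then have "card (edges G) \<le> ex_K33 (card A) + ex_K33 (card B)"
        using edges_cover[OF pg sub 2(5)] sub lt by (meson add_mono le_trans)
      moreover have "card A + card B \<le> n + 1"
        using card_Un_Int[OF fin] 2 less.prems(3) by simp
      \<comment> \<open>Truncated subtraction makes this linear bound 0 for
        \<open>card X \<le> 1\<close>, so it holds for pieces of every size.\<close>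
      moreover have "ex_K33 (card X) \<le> 3 * card X - 5" for X :: "'a set"
        by (auto simp: ex_K33_def)
      moreover have "3 * n - 6 \<le> ex_K33 n" "n = 2 \<Longrightarrow> ex_K33 n = 1"
        using True by (auto simp: ex_K33_def)
      \<comment> \<open>Two pieces with at least two vertices each give at most
        \<open>3 * (n + 1) - 10\<close>. The case \<open>n = 2\<close> is separate because
        \<open>3 * n - 6\<close> is then 0, while the true extremal number is 1.\<close>
      moreover have "(3 * card A - 5) + (3 * card B - 5) < 3 * n - 6 \<or>
          n = 2 \<and> (3 * card A - 5) + (3 * card B - 5) < 1"
        using lt True \<open>card A + card B \<le> n + 1\<close> by arith
      ultimately have "card (edges G) < ex_K33 n"
        by (smt (verit) add_mono le_less_trans less_le_trans)
      then show ?thesis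
        by simp
    qed
  qed
qed

section \<open>Extremal graphs\<close>

text \<open>The fibres of \<open>f\<close> are the cliques. Peeling off the fibre of one vertex
  leaves a graph of the same form on a strictly smaller set.\<close>

lemma sum_of_cliques_fibres:
  assumes "finite V"
  shows "sum_of_cliques \<lparr>pverts = V, parcs = {(u, v) \<in> V \<times> V. u \<noteq> v \<and> f u = f v}\<rparr>"
  using assms
proof (induction V rule: finite_psubset_induct)
  case (psubset V)
  let ?G = "\<lambda>V. \<lparr>pverts = V, parcs = {(u, v) \<in> V \<times> V. u \<noteq> v \<and> f u = f v}\<rparr>"
  show ?case
  proof (cases "V = {}")
    case True
    then show ?thesis
      using sum_of_cliques.empty by (simp add: null_graph_def)
  next
    case False
    then obtain x where "x \<in> V"
      by blast
    define K where "K = {y \<in> V. f y = f x}"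
    have "finite K"
      using psubset.hyps by (simp add: K_def)
    then have "clique (?G K)"
      unfolding clique_def complete_digraph_pair_def by (auto simp: K_def)
    moreover have "sum_of_cliques (?G (V - K))"
      using \<open>x \<in> V\<close> by (intro psubset.IH) (auto simp: K_def)
    ultimately have "sum_of_cliques (gsum (?G K) (?G (V - K)))"
      by (intro sum_of_cliques.add) auto
    moreover have "gsum (?G K) (?G (V - K)) = ?G V"
      by (auto simp: gsum_def K_def)
    ultimately show ?thesis
      by simp
  qed
qed

text \<open>
  The vertices labelled 0 and 1 are joined to everything; the remaining ones are grouped by
  their labels into triangles \<open>{2, 3, 4}, {5, 6, 7}, \<dots>\<close>, the last of which may be cut off.
\<close>
definition triangles_join :: "('a \<Rightarrow> nat) \<Rightarrow> 'a set \<Rightarrow> 'a pair_pre_digraph" where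
  "triangles_join h V = \<lparr>pverts = V, parcs = {(u, v) \<in> V \<times> V.
     u \<noteq> v \<and> (h u < 2 \<or> h v < 2 \<or> (h u - 2) div 3 = (h v - 2) div 3)}\<rparr>"

lemma pverts_triangles_join [simp]: "pverts (triangles_join h V) = V"
  by (simp add: triangles_join_def)

lemma pair_graph_triangles_join: "finite V \<Longrightarrow> pair_graph (triangles_join h V)"
  unfolding pair_graph_iff by (auto simp: triangles_join_def sym_def irrefl_def)

text \<open>A vertex labelled below 2 is adjacent to all others and hence lies on no induced path
  with four vertices; among the other labels, adjacency means lying in the same group.\<close>

lemma cograph_triangles_join: "finite V \<Longrightarrow> cograph (triangles_join h V)"
  unfolding cograph_iff by (simp add: pair_graph_triangles_join, simp add: triangles_join_def) (metis not_less)

text \<open>Each side has a vertex labelled at least 2, since only two labels are smaller. All such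
  vertices of both sides lie in one group, so the six vertices would share five labels.\<close>

lemma K33_free_triangles_join:
  assumes "finite V" "inj_on h V"
  shows "\<not> contains_K33 (triangles_join h V)"
proof
  assume "contains_K33 (triangles_join h V)"
  then obtain U W where UW: "U \<inter> W = {}" "card U = 3" "card W = 3" "U \<times> W \<subseteq> parcs (triangles_join h V)"
    using contains_K33_iff[OF pair_graph_triangles_join[OF assms(1)]] by blast
  have fin: "finite U" "finite W"
    using UW by (auto intro: card_ge_0_finite)
  have ne: "U \<noteq> {}" "W \<noteq> {}"
    using UW by auto
  have "U \<subseteq> V" "W \<subseteq> V"
    using UW(4) ne by (auto simp: triangles_join_def)
  then have inj: "inj_on h (U \<union> W)"
    by (meson assms(2) Un_least inj_on_subset)
  have ex: "\<exists>x\<in>X. 2 \<le> h x" if "card X = 3" "X \<subseteq> U \<union> W" for X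
  proof (rule ccontr)
    assume "\<not> ?thesis"
    then have "h ` X \<subseteq> {0, 1}"
      by (auto simp: less_2_cases_iff)
    then have "card (h ` X) \<le> card {0::nat, 1}"
      by (intro card_mono) auto
    moreover have "card (h ` X) = card X"
      using that(2) inj by (meson card_image inj_on_subset)
    ultimately show False
      using that(1) by simp
  qed
  obtain u w where uw: "u \<in> U" "2 \<le> h u" "w \<in> W" "2 \<le> h w"
    using ex[of U] ex[of W] UW by auto
  define k where "k = (h u - 2) div 3"
  have W: "(h y - 2) div 3 = k" if "y \<in> W" "2 \<le> h y" for y
    using UW(4) uw that by (auto simp: triangles_join_def k_def)
  have U: "(h x - 2) div 3 = k" if "x \<in> U" "2 \<le> h x" for x
  proof -
    have "(h x - 2) div 3 = (h w - 2) div 3"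
      using UW(4) uw that by (auto simp: triangles_join_def)
    then show ?thesis
      using W[of w] uw by simp
  qed
  have "h x \<in> {0, 1, 3 * k + 2, 3 * k + 3, 3 * k + 4}" if "x \<in> U \<union> W" for x
  proof (cases "2 \<le> h x")
    case True
    then have "(h x - 2) div 3 = k"
      using that U W by blast
    then show ?thesis
      using True by auto
  qed auto
  then have "h ` (U \<union> W) \<subseteq> {0, 1, 3 * k + 2, 3 * k + 3, 3 * k + 4}"
    by (rule image_subsetI)
  then have "card (h ` (U \<union> W)) \<le> card {0, 1, 3 * k + 2, 3 * k + 3, 3 * k + 4}"
    by (intro card_mono) auto
  moreover have "card {0, 1, 3 * k + 2, 3 * k + 3, 3 * k + 4} \<le> 5"
    by (simp add: card_insert_if)
  moreover have "card (h ` (U \<union> W)) = 6"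
    using card_image[OF inj] card_Un_disjoint[OF fin UW(1)] UW by simp
  ultimately show False
    by simp
qed

text \<open>A new vertex \<open>n\<close> gains at least \<open>2 + (n - 2) mod 3\<close> edges: two
  to the vertices 0 and 1, and one to each earlier member of its group. This covers the growth of
  \<open>ex_K33\<close>.\<close>

lemma card_edges_triangles_join_nat:
  "2 \<le> n \<Longrightarrow> ex_K33 n \<le> card (edges (triangles_join id {..<n}))"
proof (induction n rule: nat_induct_at_least)
  case base
  have "{0, 1} \<in> edges (triangles_join id {..<2::nat})"
    by (force simp: edges_def triangles_join_def)
  then have "card {{0::nat, 1}} \<le> card (edges (triangles_join id {..<2::nat}))"
    by (intro card_mono finite_edges pair_graph_triangles_join) auto
  then show ?case
    by (simp add: ex_K33_def del: id_apply)
next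
  case (Suc n)
  let ?T = "\<lambda>n. triangles_join id {..<n::nat}"
  \<comment> \<open>Earlier neighbours of \<open>n\<close>: the vertices 0 and 1, and the members of
    its group below \<open>n\<close>; the least label of the group is
    \<open>2 + 3 * ((n - 2) div 3)\<close>.\<close>
  define D where "D = {0, 1} \<union> {2 + 3 * ((n - 2) div 3)..<n}"
  have fin: "finite (edges (?T n))" for n
    by (intro finite_edges pair_graph_triangles_join) simp
  have "edges (?T n) \<union> (\<lambda>u. {u, n}) ` D \<subseteq> edges (?T (Suc n))"
  proof (intro Un_least subsetI)
    fix e
    assume "e \<in> edges (?T n)"
    then show "e \<in> edges (?T (Suc n))"
      by (force simp: edges_def triangles_join_def)
  next
    fix e
    assume "e \<in> (\<lambda>u. {u, n}) ` D"
    then obtain u where u: "u \<in> D" "e = {u, n}"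
      by blast
    have "u < n"
      using u(1) Suc.hyps by (auto simp: D_def)
    moreover have "u < 2 \<or> (u - 2) div 3 = (n - 2) div 3"
    proof (cases "u < 2")
      case False
      then have "2 + 3 * ((n - 2) div 3) \<le> u"
        using u(1) by (auto simp: D_def)
      then have "3 * ((n - 2) div 3) \<le> u - 2" "u - 2 \<le> n - 2"
        using \<open>u < n\<close> by auto
      then have "(n - 2) div 3 \<le> (u - 2) div 3" "(u - 2) div 3 \<le> (n - 2) div 3"
        by (simp_all add: less_eq_div_iff_mult_less_eq div_le_mono mult.commute)
      then show ?thesis
        by simp
    qed simp
    ultimately have "(u, n) \<in> parcs (?T (Suc n))"
      by (auto simp: triangles_join_def)
    then show "e \<in> edges (?T (Suc n))"
      using u(2) by (force simp: edges_def)
  qed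
  then have "card (edges (?T n) \<union> (\<lambda>u. {u, n}) ` D) \<le> card (edges (?T (Suc n)))"
    using fin by (intro card_mono)
  moreover have "edges (?T n) \<inter> (\<lambda>u. {u, n}) ` D = {}"
    by (auto simp: edges_def triangles_join_def doubleton_eq_iff)
  then have "card (edges (?T n) \<union> (\<lambda>u. {u, n}) ` D) = card (edges (?T n)) + card ((\<lambda>u. {u, n}) ` D)"
    using fin by (intro card_Un_disjoint) (auto simp: D_def)
  moreover have "card ((\<lambda>u. {u, n}) ` D) = card D"
    by (intro card_image inj_onI) (auto simp: doubleton_eq_iff)
  moreover have "card D = 2 + (n - 2) mod 3"
  proof -
    have "card D = 2 + (n - (2 + 3 * ((n - 2) div 3)))"
      unfolding D_def by (subst card_Un_disjoint) auto
    also have "n - (2 + 3 * ((n - 2) div 3)) = (n - 2) - 3 * ((n - 2) div 3)"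
      by (rule diff_diff_left[symmetric])
    also have "\<dots> = (n - 2) mod 3"
      by (rule minus_mult_div_eq_mod)
    finally show ?thesis .
  qed
  moreover have "ex_K33 (Suc n) \<le> ex_K33 n + (2 + (n - 2) mod 3)"
  proof -
    obtain m where m: "n = m + 2"
      using that[of "n - 2"] Suc.hyps by simp
    have "m mod 3 < 3"
      by simp
    then have "m mod 3 = 0 \<or> m mod 3 = 1 \<or> m mod 3 = 2"
      by linarith
    \<comment> \<open>The left side grows over its value at \<open>m\<close> by 2, 3 or 4 according
      to \<open>m mod 3\<close>, which is exactly \<open>2 + m mod 3\<close>.\<close>
    then have "3 * Suc m + (if 3 dvd Suc m then 1 else 0) \<le> 3 * m + (if 3 dvd m then 1 else 0) + (2 + m mod 3)"
      by (auto simp: dvd_eq_mod_eq_0 mod_Suc)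
    then show ?thesis
      by (simp add: ex_K33_def m Suc_diff_le)
  qed
  ultimately show ?case
    using Suc.IH by linarith
qed

text \<open>Transport along \<open>h\<close>: each edge of the model on \<open>{..<n}\<close> is the
  image of an edge on \<open>V\<close>, and taking images cannot increase the number of
  edges.\<close>

lemma card_edges_triangles_join:
  assumes "2 \<le> n" and h: "bij_betw h V {..<n}"
  shows "ex_K33 n \<le> card (edges (triangles_join h V))"
proof -
  have "finite V"
    using h bij_betw_finite by blast
  have "edges (triangles_join id {..<n}) \<subseteq> (`) h ` edges (triangles_join h V)"
  proof
    fix e
    assume "e \<in> edges (triangles_join id {..<n})"
    then obtain i j where ij: "e = {i, j}" "(i, j) \<in> parcs (triangles_join id {..<n})"
      by (auto simp: edges_def)
    have "i \<in> h ` V" "j \<in> h ` V"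
      using h ij(2) by (auto simp: triangles_join_def bij_betw_def)
    then obtain u v where uv: "u \<in> V" "v \<in> V" "i = h u" "j = h v"
      by blast
    then have "(u, v) \<in> parcs (triangles_join h V)"
      using ij(2) by (auto simp: triangles_join_def)
    then have "{u, v} \<in> edges (triangles_join h V)"
      by (force simp: edges_def)
    moreover have "e = h ` {u, v}"
      using ij uv by simp
    ultimately show "e \<in> (`) h ` edges (triangles_join h V)"
      by blast
  qed
  then have "card (edges (triangles_join id {..<n})) \<le> card (edges (triangles_join h V))"
    using \<open>finite V\<close> by (intro surj_card_le finite_edges pair_graph_triangles_join)
  then show ?thesis
    using card_edges_triangles_join_nat[OF assms(1)] by simp
qed

lemma triangles_join_maximal:
  assumes "2 \<le> n" and h: "bij_betw h V {..<n}"
  shows "edge_maximal_K33_free_cograph n (triangles_join h V)"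
  unfolding edge_maximal_K33_free_cograph_def
proof (intro conjI allI impI)
  have fin: "finite V" "inj_on h V"
    using h bij_betw_finite bij_betw_imp_inj_on by blast+
  show "cograph (triangles_join h V)" "\<not> contains_K33 (triangles_join h V)"
    using fin cograph_triangles_join K33_free_triangles_join by blast+
  show "card (pverts (triangles_join h V)) = n"
    using bij_betw_same_card[OF h] by simp
  fix H :: "'a pair_pre_digraph"
  assume "cograph H \<and> card (pverts H) = n \<and> \<not> contains_K33 H"
  then show "card (edges H) \<le> card (edges (triangles_join h V))"
    using card_edges_K33_free_cograph[of H n] card_edges_triangles_join[OF assms] by linarith
qed

section \<open>Product decompositions\<close>

lemma join_eq_gprod:
  assumes "pair_graph G" "S \<subseteq> pverts G" "S \<times> (pverts G - S) \<subseteq> parcs G"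
  shows "G = gprod (induce G S) (induce G (pverts G - S))"
proof -
  note G = pair_graphD[OF assms(1)]
  have "parcs G = parcs (gprod (induce G S) (induce G (pverts G - S)))"
    using G(3,6) assms by (auto simp: gprod_def)
  moreover have "pverts G = pverts (gprod (induce G S) (induce G (pverts G - S)))"
    using assms(2) by (auto simp: gprod_def)
  ultimately show ?thesis
    by simp
qed

theorem theorem4:
  shows "(\<forall>n \<ge> 2. \<forall>G :: 'a pair_pre_digraph. edge_maximal_K33_free_cograph n G \<longrightarrow>
            (\<exists>G1 G2. cograph G1 \<and> card (pverts G1) = 2 \<and> cograph G2 \<and>
               pverts G1 \<inter> pverts G2 = {} \<and> G = gprod G1 G2)) \<and>
         (\<forall>n \<ge> 2. \<exists>G :: nat pair_pre_digraph. edge_maximal_K33_free_cograph n G \<and>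
            (\<exists>G1 G2. complete_digraph 2 (with_proj G1) \<and> sum_of_cliques G2 \<and>
               pverts G1 \<inter> pverts G2 = {} \<and> G = gprod G1 G2))"
proof (intro conjI allI impI)
  fix n :: nat and G :: "'a pair_pre_digraph"
  assume n: "2 \<le> n" and max: "edge_maximal_K33_free_cograph n G"
  then have G: "cograph G" "card (pverts G) = n" "\<not> contains_K33 G"
    by (simp_all add: edge_maximal_K33_free_cograph_def)
  have pg: "pair_graph G"
    using G(1) by (simp add: cograph_iff)
  \<comment> \<open>Labelling the vertices of \<open>G\<close> itself builds an extremal competitor
    on the same type; comparison with it shows that \<open>G\<close> attains
    \<open>ex_K33 n\<close>, which excludes the strict alternative.\<close>
  obtain h where h: "bij_betw h (pverts G) {..<n}"
    using ex_bij_betw_finite_nat[OF pair_graphD(1)[OF pg]] G(2) by (auto simp: atLeast0LessThan)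
  have "edge_maximal_K33_free_cograph n (triangles_join h (pverts G))"
    using triangles_join_maximal[OF n h] .
  then have "card (edges (triangles_join h (pverts G))) \<le> card (edges G)"
    using max by (simp add: edge_maximal_K33_free_cograph_def)
  then have "ex_K33 n \<le> card (edges G)"
    using card_edges_triangles_join[OF n h] by simp
  then obtain S where S: "S \<subseteq> pverts G" "card S = 2" "S \<times> (pverts G - S) \<subseteq> parcs G"
    using card_edges_K33_free_cograph[OF G(1,3,2)] n \<open>ex_K33 n \<le> card (edges G)\<close>
    by (auto simp: not_less[symmetric])
  show "\<exists>G1 G2. cograph G1 \<and> card (pverts G1) = 2 \<and> cograph G2 \<and>
               pverts G1 \<inter> pverts G2 = {} \<and> G = gprod G1 G2"
    using join_eq_gprod[OF pg S(1,3)] cograph_induce[OF G(1)] S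
    by (intro exI[of _ "induce G S"] exI[of _ "induce G (pverts G - S)"]) auto
next
  fix n :: nat
  assume n: "2 \<le> n"
  define G :: "nat pair_pre_digraph" where "G = triangles_join id {..<n}"
  have pg: "pair_graph G"
    by (simp add: G_def pair_graph_triangles_join)
  have sub: "{0, 1} \<subseteq> pverts G" "{0, 1} \<times> (pverts G - {0, 1}) \<subseteq> parcs G"
    using n by (auto simp: G_def triangles_join_def)
  have "complete_digraph 2 (with_proj (induce G {0, 1}))"
    unfolding complete_digraph_pair_def using n by (auto simp: G_def triangles_join_def)
  \<comment> \<open>Without 0 and 1, adjacency is equality of group indices, so the cliques are the
    fibres of \<open>(u - 2) div 3\<close>.\<close>
  moreover have "induce G (pverts G - {0, 1}) = \<lparr>pverts = {..<n} - {0, 1},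
      parcs = {(u, v) \<in> ({..<n} - {0, 1}) \<times> ({..<n} - {0, 1}). u \<noteq> v \<and> (u - 2) div 3 = (v - 2) div 3}\<rparr>"
    by (auto simp: G_def triangles_join_def induce_def less_2_cases_iff)
  then have "sum_of_cliques (induce G (pverts G - {0, 1}))"
    using sum_of_cliques_fibres[of "{..<n} - {0, 1}" "\<lambda>u. (u - 2) div 3"] by simp
  moreover have "edge_maximal_K33_free_cograph n G"
    unfolding G_def by (rule triangles_join_maximal[OF n]) simp
  ultimately show "\<exists>G :: nat pair_pre_digraph. edge_maximal_K33_free_cograph n G \<and>
            (\<exists>G1 G2. complete_digraph 2 (with_proj G1) \<and> sum_of_cliques G2 \<and>
               pverts G1 \<inter> pverts G2 = {} \<and> G = gprod G1 G2)"
    using join_eq_gprod[OF pg sub]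
    by (intro exI[of _ G] conjI exI[of _ "induce G {0, 1}"] exI[of _ "induce G (pverts G - {0, 1})"]) auto
qed

end
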